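(* There exist $M,\varepsilon>0$ such that, setting $$\rho_{M,\varepsilon}=\Big(\frac{1}{6\varepsilon}\,1_{[1,1+5\varepsilon]}+\frac16\,1_{[M,M+1]}\Big)\,dr,$$ a probability measure on $\mathbb{R}_+=(0,\infty)$, none of the maps in the $\{D,I\}^3$-class associated to $\rho_{M,\varepsilon}$ is optimal in the cyclical Monge problem $$\inf\Big\{\int_{\mathbb{R}_+}c\big(x,S(x),S^{(2)}(x)\big)\,d\rho_{M,\varepsilon}(x)\;:\;S:\mathbb{R}_+\to\mathbb{R}_+\text{ Borel},\ S_\sharp\rho_{M,\varepsilon}=\rho_{M,\varepsilon},\ S^{(3)}=\mathrm{Id}\Big\}.$$
   Context: Notation: $\mathbb{R}_+=(0,\infty)$; $S^{(k)}$ is the $k$-fold composition of $S$ with itself; $S_\sharp\rho$ is the push-forward measure. Maps, and the identity $S^{(3)}=\mathrm{Id}$, are understood up to $\rho$-negligible sets. A map is optimal in the Monge problem if it is admissible and attains the infimum. Cost. For $r_1,r_2,r_3\in\mathbb{R}_+$, $$c(r_1,r_2,r_3)=\min\Big\{\frac1{|v_2-v_1|}+\frac1{|v_3-v_2|}+\frac1{|v_1-v_3|}\;:\;v_i\in\mathbb{R}^2,\ |v_i|=r_i,\ i=1,2,3\Big\}.$$ $\{D,I\}^3$-class. Let $\rho$ be a non-atomic probability measure on $\mathbb{R}_+$ and let $d_1,d_2\in\mathbb{R}_+$ be such that $\rho((0,d_1])=\rho([d_1,d_2])=\rho([d_2,\infty))=1/3$. For a word $w_1w_2w_3$ with letters in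 $\{D,I\}$, the $w_1w_2w_3$-map associated to $\rho$ is the unique (up to $\rho$-negligible sets) map $T:\mathbb{R}_+\to\mathbb{R}_+$ with $T_\sharp\rho=\rho$ that maps $(0,d_1)$ onto $(d_1,d_2)$ monotonically with monotonicity $w_1$, $(d_1,d_2)$ onto $(d_2,\infty)$ with monotonicity $w_2$, and $(d_2,\infty)$ onto $(0,d_1)$ with monotonicity $w_3$, where $D$ means decreasing and $I$ means increasing (that is, on each of the three intervals $T$ is the monotone map of the indicated type pushing the restriction of $\rho$ to that interval forward to the restriction of $\rho$ to the target interval). The $\{D,I\}^3$-class associated to $\rho$ consists of those maps of this form satisfying $T^{(3)}=\mathrm{Id}$, namely the four maps $III$, $IDD$, $DID$ and $DDI$. *)

theory Defs
  imports "HOL-Probability.Probability"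
begin

definition Rplus :: "real measure" where
  "Rplus = restrict_space borel {0<..}"

text \<open>
  The values are in \<^typ>\<open>ennreal\<close>, where \<open>1 / 0 = \<infinity>\<close>: coinciding points have infinite
  energy (on the reals they would contribute \<open>0\<close>).
\<close>

definition coulomb_energy :: "real ^ 2 \<Rightarrow> real ^ 2 \<Rightarrow> real ^ 2 \<Rightarrow> ennreal" where
  "coulomb_energy v1 v2 v3 =
     1 / ennreal (norm (v2 - v1)) + 1 / ennreal (norm (v3 - v2)) + 1 / ennreal (norm (v1 - v3))"

definition cost :: "real \<Rightarrow> real \<Rightarrow> real \<Rightarrow> ennreal" where
  "cost r1 r2 r3 =
     Inf {coulomb_energy v1 v2 v3 | v1 v2 v3. norm v1 = r1 \<and> norm v2 = r2 \<and> norm v3 = r3}"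

lemma cost_attained:
  assumes "r1 > 0" "r2 > 0" "r3 > 0"
  shows "\<exists>v1 v2 v3. norm v1 = r1 \<and> norm v2 = r2 \<and> norm v3 = r3 \<and>
           cost r1 r2 r3 = coulomb_energy v1 v2 v3"
proof -
  let ?K = "sphere (0 :: real ^ 2) r1 \<times> sphere (0 :: real ^ 2) r2 \<times> sphere (0 :: real ^ 2) r3"
  let ?f = "\<lambda>(v1, v2, v3). coulomb_energy v1 v2 v3"
  have "compact ?K"
    by (intro compact_Times compact_sphere)
  moreover have "?K \<noteq> {}"
    using assms by auto
  moreover have "continuous_on ?K ?f"
    unfolding coulomb_energy_def divide_ennreal_def case_prod_unfold mult_1
    by (intro continuous_on_add_ennreal continuous_on_inverse_ennreal continuous_on_ennreal
          continuous_intros)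
  ultimately obtain p where p: "p \<in> ?K" "\<forall>q\<in>?K. ?f p \<le> ?f q"
    using continuous_attains_inf[of ?K ?f] by blast
  obtain v1 v2 v3 where v: "p = (v1, v2, v3)"
    by (cases p) auto
  have "cost r1 r2 r3 = coulomb_energy v1 v2 v3"
    unfolding cost_def
  proof (rule cInf_eq_minimum)
    show "coulomb_energy v1 v2 v3 \<in>
        {coulomb_energy v1 v2 v3 | v1 v2 v3. norm v1 = r1 \<and> norm v2 = r2 \<and> norm v3 = r3}"
      using p(1) v by auto
  next
    fix x
    assume "x \<in> {coulomb_energy v1 v2 v3 | v1 v2 v3. norm v1 = r1 \<and> norm v2 = r2 \<and> norm v3 = r3}"
    then show "coulomb_energy v1 v2 v3 \<le> x"
      using p(2) v by auto
  qed
  then show ?thesis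
    using p(1) v by auto
qed

definition admissible :: "real measure \<Rightarrow> (real \<Rightarrow> real) \<Rightarrow> bool" where
  "admissible \<rho> S \<longleftrightarrow>
     S \<in> Rplus \<rightarrow>\<^sub>M Rplus \<and> distr \<rho> Rplus S = \<rho> \<and> (AE x in \<rho>. (S ^^ 3) x = x)"

definition monge_cost :: "real measure \<Rightarrow> (real \<Rightarrow> real) \<Rightarrow> ennreal" where
  "monge_cost \<rho> S = (\<integral>\<^sup>+ x. cost x (S x) ((S ^^ 2) x) \<partial>\<rho>)"

definition optimal :: "real measure \<Rightarrow> (real \<Rightarrow> real) \<Rightarrow> bool" where
  "optimal \<rho> S \<longleftrightarrow>
     admissible \<rho> S \<and> monge_cost \<rho> S = (INF S' \<in> {S'. admissible \<rho> S'}. monge_cost \<rho> S')"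

datatype monotonicity = Decr | Incr

fun monotone_type :: "monotonicity \<Rightarrow> real set \<Rightarrow> (real \<Rightarrow> real) \<Rightarrow> bool" where
  "monotone_type Decr A T \<longleftrightarrow> antimono_on A T"
| "monotone_type Incr A T \<longleftrightarrow> mono_on A T"

text \<open>
  \<open>T\<close> maps \<open>A\<close> onto \<open>B\<close> with monotonicity \<open>w\<close>, up to a \<open>\<rho>\<close>-negligible set; the density of \<open>\<rho>\<close>
  with respect to an indicator is the restriction of \<open>\<rho>\<close> as a measure on the whole half-line.
\<close>

definition monotone_transport ::
    "real measure \<Rightarrow> monotonicity \<Rightarrow> real set \<Rightarrow> real set \<Rightarrow> (real \<Rightarrow> real) \<Rightarrow> bool" where
  "monotone_transport \<rho> w A B T \<longleftrightarrow>
     (\<exists>N \<in> null_sets \<rho>. monotone_type w (A - N) T) \<and>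
     distr (density \<rho> (indicator A)) Rplus T = density \<rho> (indicator B)"

definition is_word_map ::
    "real measure \<Rightarrow> monotonicity \<Rightarrow> monotonicity \<Rightarrow> monotonicity \<Rightarrow> (real \<Rightarrow> real) \<Rightarrow> bool" where
  "is_word_map \<rho> w1 w2 w3 T \<longleftrightarrow>
     T \<in> Rplus \<rightarrow>\<^sub>M Rplus \<and> distr \<rho> Rplus T = \<rho> \<and>
     (\<exists>d1 > 0. \<exists>d2 > 0.
        measure \<rho> {0<..d1} = 1/3 \<and> measure \<rho> {d1..d2} = 1/3 \<and> measure \<rho> {d2..} = 1/3 \<and>
        monotone_transport \<rho> w1 {0<..<d1} {d1<..<d2} T \<and>
        monotone_transport \<rho> w2 {d1<..<d2} {d2<..} T \<and>
        monotone_transport \<rho> w3 {d2<..} {0<..<d1} T)"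

text \<open>
  The condition \<open>T\<^sup>3 = Id\<close> selects the words \<open>III\<close>, \<open>IDD\<close>, \<open>DID\<close> and \<open>DDI\<close>.
\<close>

definition DI_class :: "real measure \<Rightarrow> (real \<Rightarrow> real) set" where
  "DI_class \<rho> = {T. (\<exists>w1 w2 w3. is_word_map \<rho> w1 w2 w3 T) \<and> (AE x in \<rho>. (T ^^ 3) x = x)}"

definition rho :: "real \<Rightarrow> real \<Rightarrow> real measure" where
  "rho M \<epsilon> = density (restrict_space lborel {0<..})
     (\<lambda>r. ennreal (1 / (6 * \<epsilon>) * indicator {1..1 + 5 * \<epsilon>} r + 1 / 6 * indicator {M..M + 1} r))"

end

theory Submission
  imports Defs
begin

text \<open>
  Write \<open>r = 1 + \<epsilon> s\<close> for the radii near \<open>1\<close>. To first order in \<open>\<epsilon>\<close>, three near points with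
  parameters \<open>s\<^sub>i\<close> cost \<open>\<surd>3 - \<epsilon> (s\<^sub>1 + s\<^sub>2 + s\<^sub>3) / \<surd>3\<close>, while two near points and one far point
  cost \<open>1/2 - \<epsilon> (s\<^sub>1 + s\<^sub>2) / 4\<close>. Since \<open>1/\<surd>3 > 1/4\<close>, the points with small \<open>s\<close> should be the ones
  matched with the far mass: a competitor joining \<open>[0, 1]\<close>, \<open>[1, 2]\<close> to the far interval and
  \<open>[2, 3]\<close>, \<open>[3, 4]\<close>, \<open>[4, 5]\<close> to each other achieves this. A map of the class instead takes one
  point in each third \<open>[0, 2]\<close>, \<open>[2, 4]\<close>, \<open>[4, 5] \<union> far\<close>; Kantorovich potentials for that three-marginal
  problem bound its cost from below, whatever the monotonicities, and this bound exceeds the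
  cost of the competitor by a multiple of \<open>\<epsilon>\<close>.
\<close>

section \<open>Bounds on the Coulomb cost\<close>

text \<open>The tangent at \<open>3\<close> of the convex function \<open>d\<^sup>2 \<mapsto> 1 / d\<close>.\<close>

lemma ennreal_le_inverse_tangent:
  fixes d :: real
  assumes "d \<ge> 0"
  shows "ennreal ((9 - d\<^sup>2) / (6 * sqrt 3)) \<le> 1 / ennreal d"
proof (cases "d = 0")
  case True
  then show ?thesis by (simp add: divide_ennreal_def)
next
  case False
  with assms have d: "d > 0" by simp
  \<comment> \<open>The last summand vanishes; including it makes the identity polynomial in
    \<open>d\<close> and \<open>sqrt 3\<close>. The factorisation shows that \<open>sqrt 3\<close>
    is a double root, as tangency requires.\<close>
  have "(d - sqrt 3)\<^sup>2 * (d + 2 * sqrt 3) = d ^ 3 - 9 * d + 6 * sqrt 3 + (2 * sqrt 3 - 3 * d) * ((sqrt 3)\<^sup>2 - 3)"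
    by (simp add: power2_eq_square power3_eq_cube algebra_simps)
  moreover have "0 \<le> (d - sqrt 3)\<^sup>2 * (d + 2 * sqrt 3)"
    using d by simp
  ultimately have "0 \<le> d ^ 3 - 9 * d + 6 * sqrt 3" by simp
  then have "(9 - d\<^sup>2) / (6 * sqrt 3) \<le> 1 / d"
    using d by (simp add: field_simps power2_eq_square power3_eq_cube)
  then have "ennreal ((9 - d\<^sup>2) / (6 * sqrt 3)) \<le> ennreal (1 / d)"
    by (rule ennreal_leI)
  also have "\<dots> = 1 / ennreal d"
    using d by (simp add: divide_ennreal flip: ennreal_1)
  finally show ?thesis .
qed

text \<open>\<open>ennreal\<close> sends negative reals to \<open>0\<close>, so without sign
  conditions only subadditivity is left. It serves the sums of tangent terms and potentials whose
  signs are not examined.\<close>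

lemma ennreal_add_le: "ennreal (a + b) \<le> ennreal a + ennreal b"
proof -
  have "ennreal (a + b) \<le> ennreal (max 0 a + max 0 b)"
    by (rule ennreal_leI) auto
  also have "\<dots> = ennreal a + ennreal b"
    by (subst ennreal_plus) (auto simp: max_def ennreal_neg)
  finally show ?thesis .
qed

lemma inverse_ennreal_le:
  assumes "0 < b" "b \<le> d"
  shows "1 / ennreal d \<le> ennreal (1 / b)"
proof -
  have "1 / ennreal d = ennreal (1 / d)"
    using assms by (simp add: divide_ennreal flip: ennreal_1)
  also have "\<dots> \<le> ennreal (1 / b)"
    using assms by (intro ennreal_leI) (simp add: frac_le)
  finally show ?thesis .
qed

text \<open>Cyclic invariance allows an orbit to be read from whichever of its three points is
  convenient.\<close>

lemma cost_rotate: "cost a b c = cost b c a"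
proof -
  have "coulomb_energy v1 v2 v3 = coulomb_energy v2 v3 v1" for v1 v2 v3
    by (simp add: coulomb_energy_def ac_simps)
  then show ?thesis
    unfolding cost_def by (intro arg_cong[where f = Inf]) (auto, metis+)
qed

lemma cost_le:
  assumes "norm v1 = r1" "norm v2 = r2" "norm v3 = r3"
  shows "cost r1 r2 r3 \<le> coulomb_energy v1 v2 v3"
  unfolding cost_def using assms by (intro Inf_lower) auto

lemma le_cost:
  assumes "\<And>v1 v2 v3. norm v1 = r1 \<Longrightarrow> norm v2 = r2 \<Longrightarrow> norm v3 = r3 \<Longrightarrow> C \<le> coulomb_energy v1 v2 v3"
  shows "C \<le> cost r1 r2 r3"
  unfolding cost_def using assms by (intro Inf_greatest) auto

text \<open>The squared distances add up to 3 times the sum of the squared radii minus the square of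
  the norm of \<open>v1 + v2 + v3\<close>. The tangent bound on each reciprocal distance is linear
  in the squares, hence depends only on this sum. Equality holds for the equilateral triangle on the
  unit circle.\<close>

lemma cost_ge_equilateral:
  "ennreal ((9 - (r1\<^sup>2 + r2\<^sup>2 + r3\<^sup>2)) / (2 * sqrt 3)) \<le> cost r1 r2 r3"
proof (rule le_cost)
  fix v1 v2 v3 :: "real ^ 2"
  assume r: "norm v1 = r1" "norm v2 = r2" "norm v3 = r3"
  define D where "D = (norm (v2 - v1))\<^sup>2 + (norm (v3 - v2))\<^sup>2 + (norm (v1 - v3))\<^sup>2"
  have "D + (norm (v1 + v2 + v3))\<^sup>2 = 3 * (r1\<^sup>2 + r2\<^sup>2 + r3\<^sup>2)"
    unfolding D_def r[symmetric] power2_norm_eq_inner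
    by (simp add: algebra_simps inner_commute)
  then have "D \<le> 3 * (r1\<^sup>2 + r2\<^sup>2 + r3\<^sup>2)"
    by (smt (verit) zero_le_power2)
  then have "(27 - 3 * (r1\<^sup>2 + r2\<^sup>2 + r3\<^sup>2)) / (6 * sqrt 3) \<le> (27 - D) / (6 * sqrt 3)"
    by (intro divide_right_mono) auto
  then have "(9 - (r1\<^sup>2 + r2\<^sup>2 + r3\<^sup>2)) / (2 * sqrt 3) \<le> (27 - D) / (6 * sqrt 3)"
    by (simp add: field_simps)
  also have "\<dots> = (9 - (norm (v2 - v1))\<^sup>2) / (6 * sqrt 3) + (9 - (norm (v3 - v2))\<^sup>2) / (6 * sqrt 3)
      + (9 - (norm (v1 - v3))\<^sup>2) / (6 * sqrt 3)"
    by (simp add: D_def add_divide_distrib diff_divide_distrib)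
  finally have "ennreal ((9 - (r1\<^sup>2 + r2\<^sup>2 + r3\<^sup>2)) / (2 * sqrt 3)) \<le> ennreal \<dots>"
    by (rule ennreal_leI)
  also have "\<dots> \<le> ennreal ((9 - (norm (v2 - v1))\<^sup>2) / (6 * sqrt 3))
      + ennreal ((9 - (norm (v3 - v2))\<^sup>2) / (6 * sqrt 3))
      + ennreal ((9 - (norm (v1 - v3))\<^sup>2) / (6 * sqrt 3))"
    by (intro order_trans[OF ennreal_add_le] add_mono order_refl ennreal_add_le)
  also have "\<dots> \<le> coulomb_energy v1 v2 v3"
    unfolding coulomb_energy_def by (intro add_mono ennreal_le_inverse_tangent norm_ge_zero)
  finally show "ennreal ((9 - (r1\<^sup>2 + r2\<^sup>2 + r3\<^sup>2)) / (2 * sqrt 3)) \<le> coulomb_energy v1 v2 v3" .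
qed

text \<open>Keeps only the interaction of the first two points, which is smallest when they are
  diametrically opposite. This is sharp as \<open>r3\<close> tends to infinity.\<close>

lemma cost_ge_pair:
  assumes "0 < r1" "0 < r2"
  shows "ennreal (1 / (r1 + r2)) \<le> cost r1 r2 r3"
proof (rule le_cost)
  fix v1 v2 v3 :: "real ^ 2"
  assume r: "norm v1 = r1" "norm v2 = r2"
  have "norm (v2 - v1) \<le> r1 + r2"
    using norm_triangle_ineq4[of v2 v1] r by simp
  then have "ennreal (1 / (r1 + r2)) \<le> 1 / ennreal (norm (v2 - v1))"
    using assms
    by (cases "v2 = v1") (auto simp: divide_ennreal divide_ennreal_def[of _ 0] frac_le intro!: ennreal_leI simp flip: ennreal_1)
  then show "ennreal (1 / (r1 + r2)) \<le> coulomb_energy v1 v2 v3"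
    unfolding coulomb_energy_def by (simp add: add_increasing2 add.assoc)
qed

lemma norm_vector_2: "norm (vector [a, b] :: real ^ 2) = sqrt (a\<^sup>2 + b\<^sup>2)"
  by (simp add: norm_vec_def L2_set_def UNIV_2)

lemma vector_2_diff: "(vector [a, b] :: real ^ 2) - vector [c, d] = vector [a - c, b - d]"
  by (simp add: vec_eq_iff forall_2)

text \<open>The test configuration puts the points on three rays at mutual angles of 120 degrees.
  Replacing the distances by multiples of \<open>r1 + r2\<close>, \<open>r2 + r3\<close>,
  \<open>r3 + r1\<close> is exact for equal radii and costs only second order nearby.\<close>

lemma cost_le_equilateral:
  assumes "0 < r1" "0 < r2" "0 < r3"
  shows "cost r1 r2 r3 \<le> ennreal (2 / sqrt 3 * (1 / (r1 + r2) + 1 / (r2 + r3) + 1 / (r3 + r1)))"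
proof -
  define v1 v2 v3 :: "real ^ 2" where "v1 = vector [r1, 0]"
    and "v2 = vector [- r2 / 2, r2 * sqrt 3 / 2]" and "v3 = vector [- r3 / 2, - r3 * sqrt 3 / 2]"
  have "cost r1 r2 r3 \<le> coulomb_energy v1 v2 v3"
    using assms
    by (intro cost_le)
      (simp_all add: v1_def v2_def v3_def norm_vector_2 power_mult_distrib power_divide real_sqrt_unique)
  also have "\<dots> \<le> ennreal (1 / (sqrt 3 / 2 * (r1 + r2))) + ennreal (1 / (sqrt 3 / 2 * (r2 + r3)))
      + ennreal (1 / (sqrt 3 / 2 * (r3 + r1)))"
  proof -
    have *: "sqrt 3 / 2 * (a + b) \<le> sqrt (a\<^sup>2 + a * b + b\<^sup>2)" if "a > 0" "b > 0" for a b :: real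
    proof (rule real_le_rsqrt)
      have "0 \<le> (a - b)\<^sup>2" by simp
      moreover have "(sqrt 3 / 2 * (a + b))\<^sup>2 + (a - b)\<^sup>2 / 4 = a\<^sup>2 + a * b + b\<^sup>2"
        by (simp add: power_mult_distrib power_divide) (simp add: power2_eq_square field_simps)
      ultimately show "(sqrt 3 / 2 * (a + b))\<^sup>2 \<le> a\<^sup>2 + a * b + b\<^sup>2"
        by linarith
    qed
    have "norm (v2 - v1) = sqrt (r1\<^sup>2 + r1 * r2 + r2\<^sup>2)"
      "norm (v3 - v2) = sqrt (3 * ((r2 + r3) / 2)\<^sup>2 + ((r2 - r3) / 2)\<^sup>2)"
      "norm (v1 - v3) = sqrt (r3\<^sup>2 + r3 * r1 + r1\<^sup>2)"
      by (simp_all add: v1_def v2_def v3_def vector_2_diff norm_vector_2 power2_eq_square field_simps)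
    moreover have "3 * ((r2 + r3) / 2)\<^sup>2 + ((r2 - r3) / 2)\<^sup>2 = r2\<^sup>2 + r2 * r3 + r3\<^sup>2"
      by (simp add: power2_eq_square field_simps)
    ultimately show ?thesis
      unfolding coulomb_energy_def using assms *
      by (intro add_mono inverse_ennreal_le) auto
  qed
  also have "\<dots> = ennreal (2 / sqrt 3 * (1 / (r1 + r2) + 1 / (r2 + r3) + 1 / (r3 + r1)))"
    using assms by (simp add: algebra_simps flip: ennreal_plus)
  finally show ?thesis .
qed

text \<open>The test configuration puts the near points opposite each other and the far one on the
  perpendicular axis. By the triangle inequality the far point keeps distance at least
  \<open>R\<close> from both.\<close>

lemma cost_le_far:
  assumes "0 < r1" "0 < r2" "r1 < L" "r2 < L" "0 < R"
  shows "cost r1 r2 (R + L) \<le> ennreal (1 / (r1 + r2) + 2 / R)"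
proof -
  define v1 v2 v3 :: "real ^ 2" where "v1 = vector [r1, 0]"
    and "v2 = vector [- r2, 0]" and "v3 = vector [0, R + L]"
  have n: "norm v1 = r1" "norm v2 = r2" "norm v3 = R + L"
    using assms by (simp_all add: v1_def v2_def v3_def norm_vector_2)
  have "norm (v2 - v1) = r1 + r2"
    using assms by (simp add: v1_def v2_def vector_2_diff norm_vector_2)
  moreover have "norm (v3 - v2) \<ge> R" "norm (v1 - v3) \<ge> R"
    using n assms norm_triangle_ineq2[of v3 v2] norm_triangle_ineq3[of v1 v3] by auto
  ultimately have "coulomb_energy v1 v2 v3 \<le> ennreal (1 / (r1 + r2)) + ennreal (1 / R) + ennreal (1 / R)"
    unfolding coulomb_energy_def using assms by (intro add_mono inverse_ennreal_le) auto
  also have "\<dots> = ennreal (1 / (r1 + r2) + 2 / R)"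
    using assms by (simp flip: ennreal_plus)
  finally show ?thesis
    using cost_le[OF n] by (rule order_trans[rotated])
qed

section \<open>The measure as a mixture of six uniform cells\<close>

text \<open>\<open>cell M \<epsilon> k\<close> parametrises over \<open>[0, 1)\<close>, with constant speed, the \<open>k\<close>-th of six consecutive
  intervals of \<open>\<rho>\<close>-mass \<open>1/6\<close>; the last one is \<open>[M, M + 1)\<close>.\<close>

definition cell :: "real \<Rightarrow> real \<Rightarrow> nat \<Rightarrow> real \<Rightarrow> real" where
  "cell M \<epsilon> k t = (if k < 5 then 1 + \<epsilon> * (real k + t) else M + t)"

lemma sets_rho [measurable_cong]: "sets (rho M \<epsilon>) = sets Rplus"
  by (simp add: rho_def Rplus_def sets_restrict_space)

lemma space_Rplus: "space Rplus = {0<..}"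
  by (simp add: Rplus_def space_restrict_space)

lemma space_rho: "space (rho M \<epsilon>) = {0<..}"
  by (simp add: rho_def space_restrict_space)

lemma nn_integral_affine_interval:
  assumes [measurable]: "g \<in> borel_measurable borel" and "0 < (l :: real)"
  shows "(\<integral>\<^sup>+x. g x * (ennreal (1 / l) * indicator {a..<a + l} x) \<partial>lborel)
    = (\<integral>\<^sup>+t. g (a + l * t) * indicator {0..<1} t \<partial>lborel)"
proof -
  have "(\<integral>\<^sup>+x. g x * (ennreal (1 / l) * indicator {a..<a + l} x) \<partial>lborel)
     = ennreal l * (\<integral>\<^sup>+t. g (a + l * t) * (ennreal (1 / l) * indicator {a..<a + l} (a + l * t)) \<partial>lborel)"
    using assms by (subst nn_integral_real_affine[where c = l and t = a]) auto
  also have "\<dots> = (\<integral>\<^sup>+t. ennreal l * (g (a + l * t) * (ennreal (1 / l) * indicator {a..<a + l} (a + l * t))) \<partial>lborel)"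
    by (rule nn_integral_cmult[symmetric]) measurable
  also have "\<dots> = (\<integral>\<^sup>+t. g (a + l * t) * indicator {0..<1} t \<partial>lborel)"
  proof (rule nn_integral_cong)
    fix t
    have "indicator {a..<a + l} (a + l * t) = (indicator {0..<1} t :: ennreal)"
      using assms(2) by (auto simp: indicator_def zero_le_mult_iff)
    moreover have "ennreal l * ennreal (1 / l) = 1"
      using assms(2) by (simp flip: ennreal_mult)
    ultimately show "ennreal l * (g (a + l * t) * (ennreal (1 / l) * indicator {a..<a + l} (a + l * t)))
        = g (a + l * t) * indicator {0..<1} t"
      by (metis mult.assoc mult.commute mult_1)
  qed
  finally show ?thesis .
qed

lemma rho_density_measurable [measurable]:
  "(\<lambda>r. ennreal (1 / (6 * \<epsilon>) * indicator {1..1 + 5 * \<epsilon>} r + 1 / 6 * indicator {M..M + 1} r))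
    \<in> borel_measurable (restrict_space lborel {0<..})"
  by (rule measurable_restrict_space1) measurable

text \<open>The half-open intervals are those tiled by the cells; the finite set \<open>F\<close>
  additionally discards cut points between the thirds.\<close>

lemma AE_rho:
  assumes "0 < \<epsilon>" "finite F"
  shows "AE x in rho M \<epsilon>. (x \<in> {1..<1 + 5 * \<epsilon>} \<or> x \<in> {M..<M + 1}) \<and> x \<notin> F"
proof -
  have "AE x in lborel. x \<notin> F \<union> {1 + 5 * \<epsilon>, M + 1}"
    using assms(2) by (intro AE_not_in finite_imp_null_set_lborel) simp
  then have "AE x in lborel. 0 < x \<longrightarrow>
      0 < ennreal (1 / (6 * \<epsilon>) * indicator {1..1 + 5 * \<epsilon>} x + 1 / 6 * indicator {M..M + 1} x) \<longrightarrow>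
      (x \<in> {1..<1 + 5 * \<epsilon>} \<or> x \<in> {M..<M + 1}) \<and> x \<notin> F"
    by eventually_elim (auto simp: indicator_def split: if_splits)
  then show ?thesis
    unfolding rho_def AE_density[OF rho_density_measurable] by (simp add: AE_restrict_space_iff)
qed

text \<open>Reduces integrals to averages over the six cells at a common parameter \<open>t\<close>.
  Invariance of the measure and comparison of potentials thereby become statements about finite
  sums.\<close>

lemma nn_integral_rho:
  assumes \<epsilon>: "0 < \<epsilon>" "1 + 5 * \<epsilon> < M" and f: "f \<in> borel_measurable Rplus"
  shows "(\<integral>\<^sup>+x. f x \<partial>rho M \<epsilon>)
    = (\<integral>\<^sup>+t. ennreal (1 / 6) * (\<Sum>k<6. f (cell M \<epsilon> k t)) * indicator {0..<1} t \<partial>lborel)"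
proof -
  \<comment> \<open>Extension by zero to the whole line, where the affine change of variables takes
    place.\<close>
  define g where "g x = f x * indicator {0<..} x" for x
  have g[measurable]: "g \<in> borel_measurable borel"
    using f unfolding g_def Rplus_def by (subst (asm) borel_measurable_restrict_space_iff_ennreal) auto
  define l where "l k = (if k < (5::nat) then \<epsilon> else 1)" for k
  have l: "l k > 0" for k using \<epsilon> by (simp add: l_def)
  have cell_eq: "cell M \<epsilon> k t = cell M \<epsilon> k 0 + l k * t" for k t
    by (simp add: cell_def l_def algebra_simps)
  have "(\<integral>\<^sup>+x. f x \<partial>rho M \<epsilon>) =
     (\<integral>\<^sup>+x. ennreal (1 / (6 * \<epsilon>) * indicator {1..1 + 5 * \<epsilon>} x + 1 / 6 * indicator {M..M + 1} x) * f x
        \<partial>restrict_space lborel {0<..})"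
    unfolding rho_def
  proof (rule nn_integral_density[OF rho_density_measurable])
    show "f \<in> borel_measurable (restrict_space lborel {0<..})"
      using f by (subst measurable_cong_sets[of _ Rplus _ borel]) (simp_all add: Rplus_def sets_restrict_space)
  qed
  also have "\<dots> = (\<integral>\<^sup>+x. g x * ennreal (1 / (6 * \<epsilon>) * indicator {1..1 + 5 * \<epsilon>} x + 1 / 6 * indicator {M..M + 1} x)
        \<partial>lborel)"
    by (subst nn_integral_restrict_space) (auto simp: g_def ac_simps intro!: nn_integral_cong)
  also have "\<dots> = (\<integral>\<^sup>+x. (\<Sum>k<6. ennreal (1 / 6) * (g x * (ennreal (1 / l k) * indicator {cell M \<epsilon> k 0..<cell M \<epsilon> k 0 + l k} x)))
        \<partial>lborel)"
  \<comment> \<open>Equality holds off the right endpoints of the two closed intervals, which the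
    half-open cells omit.\<close>
  proof (rule nn_integral_cong_AE)
    have "AE x in lborel. x \<notin> {1 + 5 * \<epsilon>, M + 1}"
      by (intro AE_not_in finite_imp_null_set_lborel) simp
    then show "AE x in lborel. g x * ennreal (1 / (6 * \<epsilon>) * indicator {1..1 + 5 * \<epsilon>} x + 1 / 6 * indicator {M..M + 1} x)
      = (\<Sum>k<6. ennreal (1 / 6) * (g x * (ennreal (1 / l k) * indicator {cell M \<epsilon> k 0..<cell M \<epsilon> k 0 + l k} x)))"
    proof eventually_elim
      fix x assume x: "x \<notin> {1 + 5 * \<epsilon>, M + 1}"
      have density: "1 / (6 * \<epsilon>) * indicator {1..1 + 5 * \<epsilon>} x + 1 / 6 * indicator {M..M + 1} x
        = (\<Sum>k<6. 1 / 6 * (1 / l k * indicator {cell M \<epsilon> k 0..<cell M \<epsilon> k 0 + l k} x))"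
        using x \<epsilon> by (simp add: eval_nat_numeral l_def cell_def) (auto simp: indicator_def)
      have e: "ennreal (1 / (6 * \<epsilon>) * indicator {1..1 + 5 * \<epsilon>} x + 1 / 6 * indicator {M..M + 1} x)
        = (\<Sum>k<6. ennreal (1 / 6) * (ennreal (1 / l k) * indicator {cell M \<epsilon> k 0..<cell M \<epsilon> k 0 + l k} x))"
      proof -
        have "ennreal (\<Sum>k<6. 1 / 6 * (1 / l k * indicator {cell M \<epsilon> k 0..<cell M \<epsilon> k 0 + l k} x))
          = (\<Sum>k<6. ennreal (1 / 6 * (1 / l k * indicator {cell M \<epsilon> k 0..<cell M \<epsilon> k 0 + l k} x)))"
          using less_imp_le[OF l] by (intro sum_ennreal[symmetric]) simp
        also have "\<dots> = (\<Sum>k<6. ennreal (1 / 6) * (ennreal (1 / l k) * indicator {cell M \<epsilon> k 0..<cell M \<epsilon> k 0 + l k} x))"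
          using less_imp_le[OF l] by (intro sum.cong refl) (simp add: indicator_def flip: ennreal_mult)
        finally show ?thesis
          by (simp only: density)
      qed
      show "g x * ennreal (1 / (6 * \<epsilon>) * indicator {1..1 + 5 * \<epsilon>} x + 1 / 6 * indicator {M..M + 1} x)
        = (\<Sum>k<6. ennreal (1 / 6) * (g x * (ennreal (1 / l k) * indicator {cell M \<epsilon> k 0..<cell M \<epsilon> k 0 + l k} x)))"
        by (subst e, subst sum_distrib_left, rule sum.cong[OF refl mult.left_commute])
    qed
  qed
  also have "\<dots> = (\<Sum>k<6. ennreal (1 / 6) * (\<integral>\<^sup>+x. g x * (ennreal (1 / l k) * indicator {cell M \<epsilon> k 0..<cell M \<epsilon> k 0 + l k} x) \<partial>lborel))"
    by (subst nn_integral_sum) (auto intro!: sum.cong nn_integral_cmult)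
  also have "\<dots> = (\<Sum>k<6. ennreal (1 / 6) * (\<integral>\<^sup>+t. g (cell M \<epsilon> k 0 + l k * t) * indicator {0..<1} t \<partial>lborel))"
    using l by (subst nn_integral_affine_interval) auto
  also have "\<dots> = (\<Sum>k<6. ennreal (1 / 6) * (\<integral>\<^sup>+t. g (cell M \<epsilon> k t) * indicator {0..<1} t \<partial>lborel))"
    by (simp add: cell_eq[symmetric])
  also have "\<dots> = (\<integral>\<^sup>+t. (\<Sum>k<6. ennreal (1 / 6) * (g (cell M \<epsilon> k t) * indicator {0..<1} t)) \<partial>lborel)"
    unfolding cell_def
    by (subst nn_integral_sum) (auto intro!: sum.cong nn_integral_cmult[symmetric])
  also have "\<dots> = (\<integral>\<^sup>+t. ennreal (1 / 6) * (\<Sum>k<6. f (cell M \<epsilon> k t)) * indicator {0..<1} t \<partial>lborel)"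
  proof (rule nn_integral_cong)
    fix t :: real
    have "g (cell M \<epsilon> k t) = f (cell M \<epsilon> k t)" if "t \<in> {0..<1}" for k
    proof -
      have "0 \<le> \<epsilon> * (real k + t)" using that \<epsilon> by simp
      then have "0 < 1 + \<epsilon> * (real k + t)" by linarith
      then have "cell M \<epsilon> k t > 0" using that \<epsilon> by (simp add: cell_def)
      then show ?thesis by (simp add: g_def)
    qed
    then show "(\<Sum>k<6. ennreal (1 / 6) * (g (cell M \<epsilon> k t) * indicator {0..<1} t))
      = ennreal (1 / 6) * (\<Sum>k<6. f (cell M \<epsilon> k t)) * indicator {0..<1} t"
      by (cases "t \<in> {0..<1}") (simp_all add: sum_distrib_left)
  qed
  finally show ?thesis .
qed

lemma prob_space_rho:
  assumes "0 < \<epsilon>" "1 + 5 * \<epsilon> < M"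
  shows "prob_space (rho M \<epsilon>)"
proof
  have "emeasure (rho M \<epsilon>) (space (rho M \<epsilon>)) = (\<integral>\<^sup>+x. 1 \<partial>rho M \<epsilon>)"
    by simp
  also have "\<dots> = (\<integral>\<^sup>+t. ennreal (1 / 6) * 6 * indicator {0..<1::real} t \<partial>lborel)"
    using assms by (subst nn_integral_rho) auto
  also have "ennreal (1 / 6) * 6 = 1"
    by (simp flip: ennreal_mult ennreal_numeral)
  finally show "emeasure (rho M \<epsilon>) (space (rho M \<epsilon>)) = 1"
    by simp
qed

lemma emeasure_rho_initial:
  assumes "0 < \<epsilon>" "1 + 5 * \<epsilon> < M" "1 \<le> d" "d \<le> 1 + 5 * \<epsilon>"
  shows "emeasure (rho M \<epsilon>) {0<..d} = ennreal ((d - 1) / (6 * \<epsilon>))"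
proof -
  let ?D = "\<lambda>r. ennreal (1 / (6 * \<epsilon>) * indicator {1..1 + 5 * \<epsilon>} r + 1 / 6 * indicator {M..M + 1} r)"
  have "{0<..d} \<in> sets (restrict_space lborel {0<..})"
    by (auto simp: sets_restrict_space intro!: image_eqI[where x = "{0<..d}"])
  then have "emeasure (rho M \<epsilon>) {0<..d} = (\<integral>\<^sup>+x. ?D x * indicator {0<..d} x \<partial>restrict_space lborel {0<..})"
    unfolding rho_def by (intro emeasure_density rho_density_measurable)
  also have "\<dots> = (\<integral>\<^sup>+x. ennreal (1 / (6 * \<epsilon>)) * indicator {1..d} x \<partial>lborel)"
    using assms
    by (subst nn_integral_restrict_space) (auto simp: indicator_def intro!: nn_integral_cong)
  also have "\<dots> = ennreal (1 / (6 * \<epsilon>)) * ennreal (d - 1)"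
    using assms by (simp add: nn_integral_cmult)
  also have "\<dots> = ennreal ((d - 1) / (6 * \<epsilon>))"
    using assms by (simp flip: ennreal_mult)
  finally show ?thesis .
qed

lemma measure_rho_initial:
  assumes "0 < \<epsilon>" "1 + 5 * \<epsilon> < M" "1 \<le> d" "d \<le> 1 + 5 * \<epsilon>"
  shows "measure (rho M \<epsilon>) {0<..d} = (d - 1) / (6 * \<epsilon>)"
  using emeasure_rho_initial[OF assms] assms by (simp add: measure_def)

lemma sets_rho_interval [measurable]:
  "0 < d \<Longrightarrow> {d..} \<in> sets (rho M \<epsilon>)" "0 \<le> d \<Longrightarrow> {d<..} \<in> sets (rho M \<epsilon>)"
  "0 \<le> a \<Longrightarrow> {a<..d} \<in> sets (rho M \<epsilon>)" "0 \<le> a \<Longrightarrow> {a<..<d} \<in> sets (rho M \<epsilon>)"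
  by (auto simp: sets_rho Rplus_def sets_restrict_space_iff)

text \<open>The bounds on \<open>p\<close> force \<open>d\<close> into the near interval, where the
  distribution function is affine and strictly increasing.\<close>

lemma quantile_rho:
  assumes \<epsilon>: "0 < \<epsilon>" "1 + 5 * \<epsilon> < M" and "0 < d" and p: "0 < p" "p < 5 / 6"
    and "measure (rho M \<epsilon>) {0<..d} = p"
  shows "d = 1 + 6 * \<epsilon> * p"
proof -
  interpret prob_space "rho M \<epsilon>" by (rule prob_space_rho) fact+
  have "d \<ge> 1"
  proof (rule ccontr)
    assume "\<not> d \<ge> 1"
    then have "measure (rho M \<epsilon>) {0<..d} \<le> measure (rho M \<epsilon>) {0<..1}"
      by (intro finite_measure_mono) auto
    then show False
      using measure_rho_initial[of \<epsilon> M 1] assms by simp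
  qed
  moreover have "d \<le> 1 + 5 * \<epsilon>"
  proof (rule ccontr)
    assume "\<not> d \<le> 1 + 5 * \<epsilon>"
    then have "measure (rho M \<epsilon>) {0<..1 + 5 * \<epsilon>} \<le> measure (rho M \<epsilon>) {0<..d}"
      by (intro finite_measure_mono) auto
    then show False
      using measure_rho_initial[of \<epsilon> M "1 + 5 * \<epsilon>"] assms by simp
  qed
  ultimately have "(d - 1) / (6 * \<epsilon>) = p"
    using measure_rho_initial[of \<epsilon> M d] assms by simp
  then show ?thesis
    using \<epsilon> by (simp add: field_simps)
qed

text \<open>The cut points are existentially quantified in \<open>is_word_map\<close>; this fixes
  them at cell boundaries, so the thirds are cells 0-1, 2-3 and 4-5.\<close>

lemma thirds_rho:
  assumes \<epsilon>: "0 < \<epsilon>" "1 + 5 * \<epsilon> < M" and d: "0 < d1" "0 < d2"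
    and "measure (rho M \<epsilon>) {0<..d1} = 1/3" and d2: "measure (rho M \<epsilon>) {d2..} = 1/3"
  shows "d1 = 1 + 2 * \<epsilon>" "d2 = 1 + 4 * \<epsilon>"
proof -
  interpret prob_space "rho M \<epsilon>" by (rule prob_space_rho) fact+
  show "d1 = 1 + 2 * \<epsilon>"
    using quantile_rho[of \<epsilon> M d1 "1/3"] assms by simp
  have "AE x in rho M \<epsilon>. x \<notin> {d2}"
    using AE_rho[of \<epsilon> "{d2}" M] \<epsilon> by auto
  then have "prob {0<..d2} = prob ({0<..} - {d2..})"
    using d by (intro measure_eq_AE) auto
  also have "\<dots> = 2 / 3"
    using prob_compl[of "{d2..}"] d d2 by (simp add: space_rho)
  finally show "d2 = 1 + 4 * \<epsilon>"
    using quantile_rho[of \<epsilon> M d2 "2/3"] \<epsilon> d by simp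
qed

section \<open>Separable bounds along orbits\<close>

text \<open>By invariance \<open>u\<close>, \<open>u\<close> after \<open>T\<close> and
  \<open>u\<close> after \<open>T\<close> twice have the same integral, so the value is common to
  all measure-preserving \<open>T\<close>.\<close>

lemma nn_integral_orbit:
  assumes T[measurable]: "T \<in> Rplus \<rightarrow>\<^sub>M Rplus" and inv: "distr (rho M \<epsilon>) Rplus T = rho M \<epsilon>"
    and u[measurable]: "u \<in> borel_measurable Rplus"
  shows "(\<integral>\<^sup>+x. u x + u (T x) + u (T (T x)) \<partial>rho M \<epsilon>) = 3 * (\<integral>\<^sup>+x. u x \<partial>rho M \<epsilon>)"
proof -
  have *: "(\<integral>\<^sup>+x. f (T x) \<partial>rho M \<epsilon>) = (\<integral>\<^sup>+x. f x \<partial>rho M \<epsilon>)" if [measurable]: "f \<in> borel_measurable Rplus" for f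
  proof -
    have "(\<integral>\<^sup>+x. f x \<partial>rho M \<epsilon>) = (\<integral>\<^sup>+x. f x \<partial>distr (rho M \<epsilon>) Rplus T)"
      by (simp add: inv)
    also have "\<dots> = (\<integral>\<^sup>+x. f (T x) \<partial>rho M \<epsilon>)"
      by (rule nn_integral_distr) measurable
    finally show ?thesis by simp
  qed
  have "(\<integral>\<^sup>+x. u (T (T x)) \<partial>rho M \<epsilon>) = (\<integral>\<^sup>+x. u (T x) \<partial>rho M \<epsilon>)"
    by (rule *) measurable
  moreover have "(1 + 1 + 1) * I = I + I + I" for I :: ennreal
    by (simp only: distrib_right mult_1)
  ultimately show ?thesis
    by (simp add: nn_integral_add *[OF u])
qed

text \<open>Weak Kantorovich duality, with one potential placed in all three slots.\<close>

lemma monge_cost_ge: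
  assumes "T \<in> Rplus \<rightarrow>\<^sub>M Rplus" "distr (rho M \<epsilon>) Rplus T = rho M \<epsilon>" "u \<in> borel_measurable Rplus"
    and "AE x in rho M \<epsilon>. u x + u (T x) + u (T (T x)) \<le> cost x (T x) (T (T x))"
  shows "3 * (\<integral>\<^sup>+x. u x \<partial>rho M \<epsilon>) \<le> monge_cost (rho M \<epsilon>) T"
  unfolding nn_integral_orbit[OF assms(1-3), symmetric] monge_cost_def
  using assms(4) by (intro nn_integral_mono_AE) (simp add: eval_nat_numeral)

lemma monge_cost_le:
  assumes "T \<in> Rplus \<rightarrow>\<^sub>M Rplus" "distr (rho M \<epsilon>) Rplus T = rho M \<epsilon>" "u \<in> borel_measurable Rplus"
    and "AE x in rho M \<epsilon>. cost x (T x) (T (T x)) \<le> u x + u (T x) + u (T (T x))"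
  shows "monge_cost (rho M \<epsilon>) T \<le> 3 * (\<integral>\<^sup>+x. u x \<partial>rho M \<epsilon>)"
  unfolding nn_integral_orbit[OF assms(1-3), symmetric] monge_cost_def
  using assms(4) by (intro nn_integral_mono_AE) (simp add: eval_nat_numeral)

section \<open>Potentials bounding the cost from below and from above\<close>

lemma inverse_sqrt_3_bounds: "577 / 1000 \<le> 1 / sqrt 3" "1 / sqrt 3 \<le> 578 / 1000"
proof -
  have "1731 / 1000 \<le> sqrt 3" "sqrt 3 \<le> 1733 / 1000"
    by (rule real_le_rsqrt real_le_lsqrt; simp add: power2_eq_square)+
  then show "577 / 1000 \<le> 1 / sqrt 3" "1 / sqrt 3 \<le> 578 / 1000"
    by (simp_all add: field_simps)
qed

text \<open>
  The potentials solve the problems linearised at \<open>r = 1\<close> and \<open>r = \<infinity>\<close>; the kinks of \<open>lower_pot\<close> sit where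
  the cheapest coupling of the three thirds switches from far to near partners. The \<open>\<epsilon>\<^sup>2\<close> and \<open>1 / (M - 2)\<close> terms absorb
  the remainders.
\<close>

definition lower_pot :: "real \<Rightarrow> real \<Rightarrow> real" where
  "lower_pot \<epsilon> x =
    (if x < 1 + 2 * \<epsilon> then (2 - x) / 4 - (1 / sqrt 3 - 1 / 4) * max 0 (x - 1 - \<epsilon>)
     else if x < 1 + 4 * \<epsilon> then (2 - x) / 4 - (1 / sqrt 3 - 1 / 4) * max 0 (x - 1 - 3 * \<epsilon>)
     else if x \<le> 1 + 5 * \<epsilon> then
       (4 - x) / sqrt 3 - 1 / 2 - 4 * (1 / sqrt 3 - 1 / 4) * \<epsilon> - 22 * \<epsilon>\<^sup>2
     else 0)"

definition upper_pot :: "real \<Rightarrow> real \<Rightarrow> real \<Rightarrow> real" where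
  "upper_pot M \<epsilon> x =
    (if x < 1 + 2 * \<epsilon> then (2 - x) / 4 + \<epsilon>\<^sup>2 + 1 / (M - 2)
     else if x < 1 + 5 * \<epsilon> then (2 - x) / sqrt 3 + 15 * \<epsilon>\<^sup>2
     else 0)"

lemma borel_measurable_pot [measurable]:
  "lower_pot \<epsilon> \<in> borel_measurable borel" "upper_pot M \<epsilon> \<in> borel_measurable borel"
  unfolding lower_pot_def[abs_def] upper_pot_def[abs_def] by measurable

lemma borel_measurable_Rplus:
  fixes u :: "real \<Rightarrow> 'a :: topological_space"
  shows "u \<in> borel_measurable borel \<Longrightarrow> u \<in> borel_measurable Rplus"
  unfolding Rplus_def by (rule measurable_restrict_space1)

text \<open>The kink terms switch the slope in \<open>x\<close> and \<open>y\<close> between 1/4 and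
  1/sqrt 3, and \<open>\<kappa>\<close> is the difference of these slopes. For near \<open>z\<close>
  the steep slopes match \<open>cost_ge_equilateral\<close>; for far \<open>z\<close> the kink terms
  only help, and the slopes 1/4 match \<open>cost_ge_pair\<close>.\<close>

lemma lower_pot_le_cost:
  assumes \<epsilon>: "0 < \<epsilon>" "\<epsilon> \<le> 1 / 100"
    and x: "1 \<le> x" "x < 1 + 2 * \<epsilon>" and y: "1 + 2 * \<epsilon> \<le> y" "y < 1 + 4 * \<epsilon>" and z: "1 + 4 * \<epsilon> \<le> z"
  shows "ennreal (lower_pot \<epsilon> x) + ennreal (lower_pot \<epsilon> y) + ennreal (lower_pot \<epsilon> z) \<le> cost x y z"
proof -
  define \<alpha> where "\<alpha> = 1 / sqrt 3"
  have \<alpha>: "577 / 1000 \<le> \<alpha>" "\<alpha> \<le> 578 / 1000"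
    using inverse_sqrt_3_bounds by (simp_all add: \<alpha>_def)
  define mx my where "mx = max 0 (x - 1 - \<epsilon>)" and "my = max 0 (y - 1 - 3 * \<epsilon>)"
  define \<kappa> where "\<kappa> = \<alpha> - 1 / 4"
  have \<kappa>: "0 \<le> \<kappa>" "\<kappa> \<le> 1/2" using \<alpha> by (simp_all add: \<kappa>_def)
  have u: "lower_pot \<epsilon> x = (2 - x) / 4 - \<kappa> * mx" "lower_pot \<epsilon> y = (2 - y) / 4 - \<kappa> * my"
    using x y by (simp_all add: lower_pot_def mx_def my_def \<kappa>_def \<alpha>_def)
  have mm: "0 \<le> mx" "mx \<le> \<epsilon>" "x - 1 - \<epsilon> \<le> mx" "0 \<le> my" "my \<le> \<epsilon>" "y - 1 - 3 * \<epsilon> \<le> my"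
    using x y \<epsilon> by (auto simp: mx_def my_def)
  have m: "0 \<le> \<kappa> * mx" "\<kappa> * mx \<le> \<epsilon>" "\<kappa> * (x - 1 - \<epsilon>) \<le> \<kappa> * mx"
    "0 \<le> \<kappa> * my" "\<kappa> * my \<le> \<epsilon>" "\<kappa> * (y - 1 - 3 * \<epsilon>) \<le> \<kappa> * my"
    using mm \<kappa> mult_mono[of \<kappa> 1 mx \<epsilon>] mult_mono[of \<kappa> 1 my \<epsilon>] by (auto intro!: mult_left_mono)
  \<comment> \<open>On nonnegative values \<open>ennreal\<close> is additive, so the claim becomes
    an inequality between reals.\<close>
  have nonneg: "0 \<le> lower_pot \<epsilon> x" "0 \<le> lower_pot \<epsilon> y"
    unfolding u using m x y \<epsilon> by auto
  show ?thesis
  proof (cases "z \<le> 1 + 5 * \<epsilon>")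
    case True
    have uz: "lower_pot \<epsilon> z = \<alpha> * (4 - z) - 1 / 2 - 4 * \<kappa> * \<epsilon> - 22 * \<epsilon>\<^sup>2"
      using True z \<epsilon> by (simp add: lower_pot_def \<kappa>_def \<alpha>_def)
    have "2308 / 1000 - 577 / 1000 * z \<le> \<alpha> * (4 - z)"
      using \<epsilon> \<alpha> True mult_right_mono[of "577 / 1000" \<alpha> "4 - z"] by simp
    moreover have "\<epsilon>\<^sup>2 \<le> 1 / 10000" "4 * \<kappa> * \<epsilon> \<le> 2 * \<epsilon>"
      using \<epsilon> \<kappa> power_mono[of \<epsilon> "1 / 100" 2] by (auto simp: power2_eq_square)
    ultimately have "0 \<le> lower_pot \<epsilon> z"
      unfolding uz using True \<epsilon> by linarith
    with nonneg have "ennreal (lower_pot \<epsilon> x) + ennreal (lower_pot \<epsilon> y) + ennreal (lower_pot \<epsilon> z)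
      = ennreal (lower_pot \<epsilon> x + lower_pot \<epsilon> y + lower_pot \<epsilon> z)"
      by (simp flip: ennreal_plus)
    also have "\<dots> \<le> ennreal ((9 - (x\<^sup>2 + y\<^sup>2 + z\<^sup>2)) / (2 * sqrt 3))"
    proof (rule ennreal_leI)
      \<comment> \<open>\<open>max 0 a\<close> is at least \<open>a\<close>, so the kink terms are
        replaced by their affine parts. Their offsets \<open>\<epsilon>\<close> and
        \<open>3 * \<epsilon>\<close> then cancel against the constant
        \<open>4 * \<kappa> * \<epsilon>\<close> in the potential of \<open>z\<close>.\<close>
      have "lower_pot \<epsilon> x + lower_pot \<epsilon> y + lower_pot \<epsilon> z
         \<le> (2 - x) / 4 - \<kappa> * (x - 1 - \<epsilon>) + (2 - y) / 4 - \<kappa> * (y - 1 - 3 * \<epsilon>)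
            + \<alpha> * (4 - z) - 1 / 2 - 4 * \<kappa> * \<epsilon> - 22 * \<epsilon>\<^sup>2"
        unfolding u uz using m by linarith
      also have "\<dots> = \<alpha> * (6 - (x + y + z)) - 22 * \<epsilon>\<^sup>2"
        unfolding \<kappa>_def by (simp add: algebra_simps add_divide_distrib diff_divide_distrib)
      \<comment> \<open>Each deviation from 1 is at most \<open>5 * \<epsilon>\<close>, and 0.289
        times 75 is below 22: this is the origin of the constant in
        \<open>lower_pot\<close>.\<close>
      also have "\<dots> \<le> \<alpha> * (6 - (x + y + z)) - \<alpha> / 2 * ((x - 1)\<^sup>2 + (y - 1)\<^sup>2 + (z - 1)\<^sup>2)"
      proof -
        have "(x - 1)\<^sup>2 \<le> (5 * \<epsilon>)\<^sup>2" "(y - 1)\<^sup>2 \<le> (5 * \<epsilon>)\<^sup>2" "(z - 1)\<^sup>2 \<le> (5 * \<epsilon>)\<^sup>2"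
          by (intro power_mono; use x y z True \<epsilon> in linarith)+
        then have "(x - 1)\<^sup>2 + (y - 1)\<^sup>2 + (z - 1)\<^sup>2 \<le> 75 * \<epsilon>\<^sup>2"
          by (simp add: power2_eq_square)
        then have "\<alpha> / 2 * ((x - 1)\<^sup>2 + (y - 1)\<^sup>2 + (z - 1)\<^sup>2) \<le> 578 / 2000 * (75 * \<epsilon>\<^sup>2)"
          using \<alpha> by (intro mult_mono) auto
        then show ?thesis
          using zero_le_power2[of \<epsilon>] by linarith
      qed
      also have "\<dots> = \<alpha> / 2 * (9 - (x\<^sup>2 + y\<^sup>2 + z\<^sup>2))"
        by (simp add: power2_eq_square field_simps)
      finally show "lower_pot \<epsilon> x + lower_pot \<epsilon> y + lower_pot \<epsilon> z \<le> (9 - (x\<^sup>2 + y\<^sup>2 + z\<^sup>2)) / (2 * sqrt 3)"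
        by (simp add: \<alpha>_def)
    qed
    also have "\<dots> \<le> cost x y z"
      by (rule cost_ge_equilateral)
    finally show ?thesis .
  next
    case False
    then have "lower_pot \<epsilon> z = 0"
      using \<epsilon> by (simp add: lower_pot_def)
    with nonneg have "ennreal (lower_pot \<epsilon> x) + ennreal (lower_pot \<epsilon> y) + ennreal (lower_pot \<epsilon> z)
      = ennreal (lower_pot \<epsilon> x + lower_pot \<epsilon> y)"
      by (simp flip: ennreal_plus)
    also have "\<dots> \<le> ennreal (1 / (x + y))"
    proof (rule ennreal_leI)
      \<comment> \<open>The tangent to \<open>1 / s\<close> at \<open>s = 2\<close>, cleared of
        denominators.\<close>
      have "(4 - (x + y)) * (x + y) = 4 - (x + y - 2)\<^sup>2"
        by (simp add: power2_eq_square algebra_simps)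
      then have "(4 - (x + y)) * (x + y) \<le> 4"
        by simp
      then have "(4 - (x + y)) / 4 \<le> 1 / (x + y)"
        using x y \<epsilon> by (simp add: field_simps)
      then show "lower_pot \<epsilon> x + lower_pot \<epsilon> y \<le> 1 / (x + y)"
        unfolding u using m by (simp add: field_simps)
    qed
    also have "\<dots> \<le> cost x y z"
      using x y \<epsilon> by (intro cost_ge_pair) auto
    finally show ?thesis .
  qed
qed

text \<open>Second-order Taylor polynomial at 2; multiplication by \<open>s\<close> leaves exactly
  the excess \<open>(s - 2) ^ 3 / 8\<close>, nonnegative on this side.\<close>

lemma inverse_le_taylor:
  assumes "(2 :: real) \<le> s"
  shows "1 / s \<le> (4 - s) / 4 + (s - 2)\<^sup>2 / 8"
proof -
  have "s * ((4 - s) / 4 + (s - 2)\<^sup>2 / 8) = 1 + (s - 2) ^ 3 / 8"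
    by (simp add: power2_eq_square power3_eq_cube field_simps)
  also have "\<dots> \<ge> 1"
    using assms by simp
  finally show ?thesis
    using assms by (simp add: divide_le_eq mult.commute)
qed

lemma cost_le_upper_pot_far:
  assumes \<epsilon>: "0 < \<epsilon>" "\<epsilon> \<le> 1 / 100" and M: "2 < M"
    and x: "1 \<le> x" "x < 1 + 2 * \<epsilon>" and y: "1 \<le> y" "y < 1 + 2 * \<epsilon>" and z: "M \<le> z"
  shows "cost x y z \<le> ennreal (upper_pot M \<epsilon> x) + ennreal (upper_pot M \<epsilon> y) + ennreal (upper_pot M \<epsilon> z)"
proof -
  \<comment> \<open>\<open>L = 2\<close> exceeds both near radii, so \<open>R = z - 2\<close>. The
    remainder \<open>(4 * \<epsilon>)^2 / 8\<close> and the term \<open>2 / (M - 2)\<close> are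
    shared equally by the two near potentials.\<close>
  have "cost x y ((z - 2) + 2) \<le> ennreal (1 / (x + y) + 2 / (z - 2))"
    using assms by (intro cost_le_far) auto
  also have "\<dots> \<le> ennreal (upper_pot M \<epsilon> x + upper_pot M \<epsilon> y)"
  proof (rule ennreal_leI)
    have "(x + y - 2)\<^sup>2 \<le> (4 * \<epsilon>)\<^sup>2"
      using x y by (intro power_mono) auto
    then have "1 / (x + y) \<le> (4 - (x + y)) / 4 + 2 * \<epsilon>\<^sup>2"
      using inverse_le_taylor[of "x + y"] x y by (simp add: power2_eq_square)
    moreover have "2 / (z - 2) \<le> 2 * (1 / (M - 2))"
      using M z by (simp add: frac_le)
    moreover have "upper_pot M \<epsilon> x + upper_pot M \<epsilon> y = (4 - (x + y)) / 4 + 2 * \<epsilon>\<^sup>2 + 2 * (1 / (M - 2))"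
      using x y by (simp add: upper_pot_def add_divide_distrib diff_divide_distrib)
    ultimately show "1 / (x + y) + 2 / (z - 2) \<le> upper_pot M \<epsilon> x + upper_pot M \<epsilon> y"
      by linarith
  qed
  also have "\<dots> \<le> ennreal (upper_pot M \<epsilon> x) + ennreal (upper_pot M \<epsilon> y) + ennreal (upper_pot M \<epsilon> z)"
    by (intro add_increasing2 ennreal_add_le) auto
  finally show ?thesis by simp
qed

lemma cost_le_upper_pot_near:
  assumes \<epsilon>: "0 < \<epsilon>"
    and x: "1 + 2 * \<epsilon> \<le> x" "x < 1 + 5 * \<epsilon>" and y: "1 + 2 * \<epsilon> \<le> y" "y < 1 + 5 * \<epsilon>"
    and z: "1 + 2 * \<epsilon> \<le> z" "z < 1 + 5 * \<epsilon>"
  shows "cost x y z \<le> ennreal (upper_pot M \<epsilon> x) + ennreal (upper_pot M \<epsilon> y) + ennreal (upper_pot M \<epsilon> z)"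
proof -
  define \<alpha> where "\<alpha> = 1 / sqrt 3"
  have \<alpha>: "577 / 1000 \<le> \<alpha>" "\<alpha> \<le> 578 / 1000"
    using inverse_sqrt_3_bounds by (simp_all add: \<alpha>_def)
  have "cost x y z \<le> ennreal (2 / sqrt 3 * (1 / (x + y) + 1 / (y + z) + 1 / (z + x)))"
    using assms by (intro cost_le_equilateral) auto
  also have "\<dots> \<le> ennreal (upper_pot M \<epsilon> x + upper_pot M \<epsilon> y + upper_pot M \<epsilon> z)"
  proof (rule ennreal_leI)
    \<comment> \<open>The remainder is \<open>(10 * \<epsilon>)^2 / 8\<close>. Three of these, times
      \<open>2 * \<alpha>\<close>, stay below 45 \<open>\<epsilon>\<close> squared, which gives 15
      per potential.\<close>
    have *: "1 / (a + b) \<le> (4 - (a + b)) / 4 + 25 / 2 * \<epsilon>\<^sup>2"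
      if "1 \<le> a" "1 \<le> b" "a < 1 + 5 * \<epsilon>" "b < 1 + 5 * \<epsilon>" for a b
    proof -
      have "(a + b - 2)\<^sup>2 \<le> (10 * \<epsilon>)\<^sup>2"
        using that by (intro power_mono) auto
      then show ?thesis
        using inverse_le_taylor[of "a + b"] that by (simp add: power2_eq_square)
    qed
    have "1 / (x + y) \<le> (4 - (x + y)) / 4 + 25 / 2 * \<epsilon>\<^sup>2" "1 / (y + z) \<le> (4 - (y + z)) / 4 + 25 / 2 * \<epsilon>\<^sup>2"
      "1 / (z + x) \<le> (4 - (z + x)) / 4 + 25 / 2 * \<epsilon>\<^sup>2"
      by (rule *; use x y z \<epsilon> in linarith)+
    then have "1 / (x + y) + 1 / (y + z) + 1 / (z + x) \<le> (6 - (x + y + z)) / 2 + 75 / 2 * \<epsilon>\<^sup>2"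
      by (simp add: add_divide_distrib diff_divide_distrib)
    then have "2 * \<alpha> * (1 / (x + y) + 1 / (y + z) + 1 / (z + x)) \<le> 2 * \<alpha> * ((6 - (x + y + z)) / 2 + 75 / 2 * \<epsilon>\<^sup>2)"
      using \<alpha> by (intro mult_left_mono) auto
    also have "\<dots> = \<alpha> * (6 - (x + y + z)) + \<alpha> * (75 * \<epsilon>\<^sup>2)"
      by (simp add: field_simps)
    also have "\<alpha> * (75 * \<epsilon>\<^sup>2) \<le> 578 / 1000 * (75 * \<epsilon>\<^sup>2)"
      using \<alpha> by (intro mult_right_mono) auto
    also have "\<dots> \<le> 45 * \<epsilon>\<^sup>2"
      by simp
    also have "\<alpha> * (6 - (x + y + z)) + 45 * \<epsilon>\<^sup>2 = upper_pot M \<epsilon> x + upper_pot M \<epsilon> y + upper_pot M \<epsilon> z"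
    proof -
      have pot: "upper_pot M \<epsilon> a = \<alpha> * (2 - a) + 15 * \<epsilon>\<^sup>2" if "1 + 2 * \<epsilon> \<le> a" "a < 1 + 5 * \<epsilon>" for a
        using that by (simp add: upper_pot_def \<alpha>_def)
      show ?thesis
        unfolding pot[OF x] pot[OF y] pot[OF z] by (simp add: algebra_simps)
    qed
    finally show "2 / sqrt 3 * (1 / (x + y) + 1 / (y + z) + 1 / (z + x))
        \<le> upper_pot M \<epsilon> x + upper_pot M \<epsilon> y + upper_pot M \<epsilon> z"
      by (simp add: \<alpha>_def)
  qed
  also have "\<dots> \<le> ennreal (upper_pot M \<epsilon> x) + ennreal (upper_pot M \<epsilon> y) + ennreal (upper_pot M \<epsilon> z)"
    by (intro order_trans[OF ennreal_add_le] add_mono order_refl ennreal_add_le)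
  finally show ?thesis .
qed

section \<open>The maps of the class\<close>

text \<open>The push-forward of the mass on \<open>A\<close> is the mass on \<open>B\<close>, which
  is carried by \<open>B\<close>. The statement is uniform in \<open>w\<close>, so all words are
  treated at once.\<close>

lemma AE_monotone_transport:
  assumes T: "T \<in> Rplus \<rightarrow>\<^sub>M Rplus" and "A \<in> sets (rho M \<epsilon>)" "B \<in> sets (rho M \<epsilon>)"
    and "monotone_transport (rho M \<epsilon>) w A B T"
  shows "AE x in rho M \<epsilon>. x \<in> A \<longrightarrow> T x \<in> B"
proof -
  have "AE y in density (rho M \<epsilon>) (indicator B). y \<in> B"
    using assms(3) by (subst AE_density) (auto simp: indicator_def)
  moreover have "distr (density (rho M \<epsilon>) (indicator A)) Rplus T = density (rho M \<epsilon>) (indicator B)"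
    using assms(4) by (simp add: monotone_transport_def)
  ultimately have "AE y in distr (density (rho M \<epsilon>) (indicator A)) Rplus T. y \<in> B"
    by (simp only:)
  then have "AE x in density (rho M \<epsilon>) (indicator A). T x \<in> B"
    by (rule AE_distrD[rotated]) (use T in \<open>simp cong: measurable_cong_sets add: sets_rho\<close>)
  then show ?thesis
    using assms(2) by (subst (asm) AE_density) (auto simp: indicator_def)
qed

text \<open>Almost every orbit visits the three thirds in cyclic order. After rotation to start in
  the first third, \<open>lower_pot_le_cost\<close> applies.\<close>

lemma monge_cost_DI_class_ge:
  assumes \<epsilon>: "0 < \<epsilon>" "\<epsilon> \<le> 1 / 100" "1 + 5 * \<epsilon> < M" and T: "T \<in> DI_class (rho M \<epsilon>)"
  shows "3 * (\<integral>\<^sup>+x. ennreal (lower_pot \<epsilon> x) \<partial>rho M \<epsilon>) \<le> monge_cost (rho M \<epsilon>) T"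
proof -
  obtain w1 w2 w3 where "is_word_map (rho M \<epsilon>) w1 w2 w3 T"
    using T by (auto simp: DI_class_def)
  then obtain d1 d2 where T[measurable]: "T \<in> Rplus \<rightarrow>\<^sub>M Rplus" and inv: "distr (rho M \<epsilon>) Rplus T = rho M \<epsilon>"
    and d: "0 < d1" "0 < d2" "measure (rho M \<epsilon>) {0<..d1} = 1/3" "measure (rho M \<epsilon>) {d2..} = 1/3"
    and t: "monotone_transport (rho M \<epsilon>) w1 {0<..<d1} {d1<..<d2} T"
      "monotone_transport (rho M \<epsilon>) w2 {d1<..<d2} {d2<..} T"
      "monotone_transport (rho M \<epsilon>) w3 {d2<..} {0<..<d1} T"
    unfolding is_word_map_def by blast
  have d_eq: "d1 = 1 + 2 * \<epsilon>" "d2 = 1 + 4 * \<epsilon>"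
    using thirds_rho[of \<epsilon> M d1 d2] \<epsilon> d by auto
  have T': "T \<in> rho M \<epsilon> \<rightarrow>\<^sub>M Rplus"
    using T by (simp cong: measurable_cong_sets add: sets_rho)
  \<comment> \<open>Invariance carries an almost sure property from \<open>x\<close> to
    \<open>T x\<close>, so support and step facts hold along the orbit.\<close>
  have shift: "AE x in rho M \<epsilon>. P (T x)" if "AE x in rho M \<epsilon>. P x" for P
    by (rule AE_distrD[OF T', where P = P]) (simp only: inv that)
  have supp: "AE x in rho M \<epsilon>. 1 \<le> x \<and> x \<noteq> d1 \<and> x \<noteq> d2"
  proof -
    have "AE x in rho M \<epsilon>. (x \<in> {1..<1 + 5 * \<epsilon>} \<or> x \<in> {M..<M + 1}) \<and> x \<notin> {d1, d2}"
      using \<epsilon> by (intro AE_rho) auto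
    then show ?thesis
      by eventually_elim (use \<epsilon> in auto)
  qed
  have step: "AE x in rho M \<epsilon>. (x \<in> {0<..<d1} \<longrightarrow> T x \<in> {d1<..<d2}) \<and>
      (x \<in> {d1<..<d2} \<longrightarrow> T x \<in> {d2<..}) \<and> (x \<in> {d2<..} \<longrightarrow> T x \<in> {0<..<d1})"
    using t[THEN AE_monotone_transport[OF T, rotated 2]] d by auto
  have "AE x in rho M \<epsilon>. ennreal (lower_pot \<epsilon> x) + ennreal (lower_pot \<epsilon> (T x)) + ennreal (lower_pot \<epsilon> (T (T x)))
      \<le> cost x (T x) (T (T x))"
    using supp shift[OF supp] shift[OF shift[OF supp]] step shift[OF step]
  proof eventually_elim
    case (elim x)
    let ?T2 = "T (T x)"
    consider "x < d1" | "d1 < x" "x < d2" | "d2 < x"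
      using elim by linarith
    then show ?case
    proof cases
      case 1
      then have "1 \<le> x" "d1 < T x" "T x < d2" "d2 < ?T2"
        using elim by auto
      with 1 show ?thesis
        by (intro lower_pot_le_cost \<epsilon>) (simp_all add: d_eq)
    next
      case 2
      then have "d2 < T x" "1 \<le> ?T2" "?T2 < d1"
        using elim by auto
      with 2 have "ennreal (lower_pot \<epsilon> ?T2) + ennreal (lower_pot \<epsilon> x) + ennreal (lower_pot \<epsilon> (T x)) \<le> cost ?T2 x (T x)"
        by (intro lower_pot_le_cost \<epsilon>) (simp_all add: d_eq)
      then show ?thesis
        by (simp add: cost_rotate[of ?T2] ac_simps)
    next
      case 3
      then have "1 \<le> T x" "T x < d1" "d1 < ?T2" "?T2 < d2"
        using elim by auto
      with 3 have "ennreal (lower_pot \<epsilon> (T x)) + ennreal (lower_pot \<epsilon> ?T2) + ennreal (lower_pot \<epsilon> x) \<le> cost (T x) ?T2 x"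
        by (intro lower_pot_le_cost \<epsilon>) (simp_all add: d_eq)
      then show ?thesis
        by (simp add: cost_rotate[of x] ac_simps)
    qed
  qed
  then show ?thesis
    using T inv by (intro monge_cost_ge) (auto intro!: borel_measurable_Rplus)
qed

section \<open>The competitor\<close>

text \<open>In terms of cells: \<open>0 \<rightarrow> 1 \<rightarrow> 5 \<rightarrow> 0\<close> and \<open>2 \<rightarrow> 3 \<rightarrow> 4 \<rightarrow> 2\<close>.\<close>

definition competitor :: "real \<Rightarrow> real \<Rightarrow> real \<Rightarrow> real" where
  "competitor M \<epsilon> x =
    (if 1 \<le> x \<and> x < 1 + \<epsilon> then x + \<epsilon>
     else if 1 + \<epsilon> \<le> x \<and> x < 1 + 2 * \<epsilon> then M + (x - 1 - \<epsilon>) / \<epsilon>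
     else if 1 + 2 * \<epsilon> \<le> x \<and> x < 1 + 4 * \<epsilon> then x + \<epsilon>
     else if 1 + 4 * \<epsilon> \<le> x \<and> x < 1 + 5 * \<epsilon> then x - 2 * \<epsilon>
     else if M \<le> x \<and> x < M + 1 then 1 + \<epsilon> * (x - M)
     else x)"

lemma competitor_cell:
  assumes "0 < \<epsilon>" "1 + 5 * \<epsilon> < M" "0 \<le> t" "t < 1"
  shows "competitor M \<epsilon> (cell M \<epsilon> 0 t) = cell M \<epsilon> 1 t" "competitor M \<epsilon> (cell M \<epsilon> 1 t) = cell M \<epsilon> 5 t"
    "competitor M \<epsilon> (cell M \<epsilon> 5 t) = cell M \<epsilon> 0 t" "competitor M \<epsilon> (cell M \<epsilon> 2 t) = cell M \<epsilon> 3 t"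
    "competitor M \<epsilon> (cell M \<epsilon> 3 t) = cell M \<epsilon> 4 t" "competitor M \<epsilon> (cell M \<epsilon> 4 t) = cell M \<epsilon> 2 t"
proof -
  have "0 \<le> \<epsilon> * t" "\<epsilon> * t < \<epsilon>"
    using assms by simp_all
  with assms show "competitor M \<epsilon> (cell M \<epsilon> 0 t) = cell M \<epsilon> 1 t" "competitor M \<epsilon> (cell M \<epsilon> 1 t) = cell M \<epsilon> 5 t"
    "competitor M \<epsilon> (cell M \<epsilon> 5 t) = cell M \<epsilon> 0 t" "competitor M \<epsilon> (cell M \<epsilon> 2 t) = cell M \<epsilon> 3 t"
    "competitor M \<epsilon> (cell M \<epsilon> 3 t) = cell M \<epsilon> 4 t" "competitor M \<epsilon> (cell M \<epsilon> 4 t) = cell M \<epsilon> 2 t"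
    by (simp_all add: competitor_def cell_def algebra_simps)
qed

lemma cell_exhaust:
  assumes "0 < \<epsilon>" and "x \<in> {1..<1 + 5 * \<epsilon>} \<or> x \<in> {M..<M + 1}"
  obtains k t where "k \<in> {0, 1, 2, 3, 4, 5}" "0 \<le> t" "t < 1" "x = cell M \<epsilon> k t"
proof (cases "x \<in> {M..<M + 1}")
  case True
  then show ?thesis
    by (intro that[of 5 "x - M"]) (auto simp: cell_def)
next
  case False
  define y where "y = (x - 1) / \<epsilon>"
  have y: "0 \<le> y" "y < 5" "x = 1 + \<epsilon> * y"
    using assms False by (auto simp: y_def field_simps)
  define k where "k = nat \<lfloor>y\<rfloor>"
  have k: "real k \<le> y" "y < real k + 1" "k < 5"
    unfolding k_def using y by linarith+
  show ?thesis
  proof (rule that[of k "y - real k"])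
    show "k \<in> {0, 1, 2, 3, 4, 5}" using k(3) by auto
  qed (use k y in \<open>auto simp: cell_def\<close>)
qed

lemma measurable_competitor:
  assumes "0 < \<epsilon>" "1 + 5 * \<epsilon> < M"
  shows "competitor M \<epsilon> \<in> Rplus \<rightarrow>\<^sub>M Rplus"
proof -
  have "competitor M \<epsilon> \<in> borel_measurable borel"
    unfolding competitor_def[abs_def] by measurable
  moreover have "competitor M \<epsilon> x > 0" if "x > 0" for x
    using assms that by (auto simp: competitor_def intro!: add_pos_nonneg)
  ultimately show ?thesis
    unfolding Rplus_def
    by (intro measurable_restrict_space2 measurable_restrict_space1) (auto simp: space_restrict_space)
qed

text \<open>At fixed \<open>t\<close> the six cell points are permuted by two 3-cycles. Hence sums
  over the cells are merely reordered, which gives invariance, and the third iterate is the identity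
  on the cells.\<close>

lemma admissible_competitor:
  assumes \<epsilon>: "0 < \<epsilon>" "1 + 5 * \<epsilon> < M"
  shows "admissible (rho M \<epsilon>) (competitor M \<epsilon>)"
  unfolding admissible_def
proof (intro conjI)
  show S[measurable]: "competitor M \<epsilon> \<in> Rplus \<rightarrow>\<^sub>M Rplus"
    using \<epsilon> by (rule measurable_competitor)
  show "distr (rho M \<epsilon>) Rplus (competitor M \<epsilon>) = rho M \<epsilon>"
  proof (rule measure_eqI)
    fix A assume "A \<in> sets (distr (rho M \<epsilon>) Rplus (competitor M \<epsilon>))"
    then have A[measurable]: "A \<in> sets Rplus" by simp
    have "emeasure (distr (rho M \<epsilon>) Rplus (competitor M \<epsilon>)) A
        = (\<integral>\<^sup>+x. indicator A x \<partial>distr (rho M \<epsilon>) Rplus (competitor M \<epsilon>))"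
      by simp
    also have "\<dots> = (\<integral>\<^sup>+x. indicator A (competitor M \<epsilon> x) \<partial>rho M \<epsilon>)"
      by (rule nn_integral_distr) measurable
    also have "\<dots> = (\<integral>\<^sup>+x. indicator A x \<partial>rho M \<epsilon>)"
    proof -
      have "(\<Sum>k<6. indicator A (competitor M \<epsilon> (cell M \<epsilon> k t))) = (\<Sum>k<6. indicator A (cell M \<epsilon> k t) :: ennreal)"
        if "t \<in> {0..<1}" for t
        using competitor_cell[OF \<epsilon>, of t] that
        by (simp add: lessThan_nat_numeral lessThan_Suc ac_simps)
      then show ?thesis
        by (subst (1 2) nn_integral_rho[OF \<epsilon>]) (auto intro!: nn_integral_cong simp: indicator_def[of "{0..<1}"])
    qed
    also have "\<dots> = emeasure (rho M \<epsilon>) A"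
      by (simp add: sets_rho)
    finally show "emeasure (distr (rho M \<epsilon>) Rplus (competitor M \<epsilon>)) A = emeasure (rho M \<epsilon>) A" .
  qed (simp add: sets_rho)
  have "AE x in rho M \<epsilon>. x \<in> {1..<1 + 5 * \<epsilon>} \<or> x \<in> {M..<M + 1}"
    using AE_rho[of \<epsilon> "{}" M] \<epsilon> by simp
  then show "AE x in rho M \<epsilon>. (competitor M \<epsilon> ^^ 3) x = x"
  proof eventually_elim
    case (elim x)
    obtain k t where "k \<in> {0, 1, 2, 3, 4, 5}" "0 \<le> t" "t < 1" "x = cell M \<epsilon> k t"
      using cell_exhaust[OF \<epsilon>(1) elim] .
    then show ?case
      using competitor_cell[OF \<epsilon>, of t] by (auto simp: eval_nat_numeral)
  qed
qed

lemma cell_bounds: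
  assumes "0 < \<epsilon>" "0 \<le> t" "t < 1" "k < 5"
  shows "1 + real k * \<epsilon> \<le> cell M \<epsilon> k t" "cell M \<epsilon> k t < 1 + (real k + 1) * \<epsilon>"
  using assms by (simp_all add: cell_def algebra_simps)

lemma monge_cost_competitor_le:
  assumes \<epsilon>: "0 < \<epsilon>" "\<epsilon> \<le> 1 / 100" and M: "2 < M"
  shows "monge_cost (rho M \<epsilon>) (competitor M \<epsilon>) \<le> 3 * (\<integral>\<^sup>+x. ennreal (upper_pot M \<epsilon> x) \<partial>rho M \<epsilon>)"
proof -
  have \<epsilon>': "1 + 5 * \<epsilon> < M" using \<epsilon> M by simp
  let ?S = "competitor M \<epsilon>" and ?u = "\<lambda>x. ennreal (upper_pot M \<epsilon> x)"
  have "AE x in rho M \<epsilon>. x \<in> {1..<1 + 5 * \<epsilon>} \<or> x \<in> {M..<M + 1}"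
    using AE_rho[of \<epsilon> "{}" M] \<epsilon> by simp
  then have "AE x in rho M \<epsilon>. cost x (?S x) (?S (?S x)) \<le> ?u x + ?u (?S x) + ?u (?S (?S x))"
  proof eventually_elim
    case (elim x)
    obtain k t where k: "k \<in> {0, 1, 2, 3, 4, 5}" and t: "0 \<le> t" "t < 1" and x: "x = cell M \<epsilon> k t"
      using cell_exhaust[OF \<epsilon>(1) elim] .
    note S = competitor_cell[OF \<epsilon>(1) \<epsilon>' t]
    note b = cell_bounds[OF \<epsilon>(1) t, where M = M]
    \<comment> \<open>Every orbit is a rotation of one of two triples: cells 0, 1, 5 or cells 2, 3,
      4.\<close>
    have far: "cost (cell M \<epsilon> 0 t) (cell M \<epsilon> 1 t) (cell M \<epsilon> 5 t)
        \<le> ?u (cell M \<epsilon> 0 t) + ?u (cell M \<epsilon> 1 t) + ?u (cell M \<epsilon> 5 t)"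
      using b[of 0] b[of 1] \<epsilon> M t
      by (intro cost_le_upper_pot_far) (simp_all add: cell_def[of _ _ 5])
    have near: "cost (cell M \<epsilon> 2 t) (cell M \<epsilon> 3 t) (cell M \<epsilon> 4 t)
        \<le> ?u (cell M \<epsilon> 2 t) + ?u (cell M \<epsilon> 3 t) + ?u (cell M \<epsilon> 4 t)"
      using b[of 2] b[of 3] b[of 4] \<epsilon> by (intro cost_le_upper_pot_near) simp_all
    have far': "cost (cell M \<epsilon> 1 t) (cell M \<epsilon> 5 t) (cell M \<epsilon> 0 t) = cost (cell M \<epsilon> 0 t) (cell M \<epsilon> 1 t) (cell M \<epsilon> 5 t)"
      "cost (cell M \<epsilon> 5 t) (cell M \<epsilon> 0 t) (cell M \<epsilon> 1 t) = cost (cell M \<epsilon> 0 t) (cell M \<epsilon> 1 t) (cell M \<epsilon> 5 t)"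
      by (metis cost_rotate)+
    have near': "cost (cell M \<epsilon> 3 t) (cell M \<epsilon> 4 t) (cell M \<epsilon> 2 t) = cost (cell M \<epsilon> 2 t) (cell M \<epsilon> 3 t) (cell M \<epsilon> 4 t)"
      "cost (cell M \<epsilon> 4 t) (cell M \<epsilon> 2 t) (cell M \<epsilon> 3 t) = cost (cell M \<epsilon> 2 t) (cell M \<epsilon> 3 t) (cell M \<epsilon> 4 t)"
      by (metis cost_rotate)+
    show ?case
      using k far near unfolding x by (auto simp only: insert_iff empty_iff S far' near' ac_simps)
  qed
  then show ?thesis
    using admissible_competitor[OF \<epsilon>(1) \<epsilon>']
    by (intro monge_cost_le) (auto simp: admissible_def intro!: borel_measurable_Rplus)
qed

section \<open>The gap between the two bounds, and the conclusion\<close>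

text \<open>Zeroth-order terms and all terms in \<open>t\<close> cancel. The difference of the sums
  is \<open>(1 / sqrt 3 - 1 / 4) * \<epsilon>\<close> minus 69 \<open>\<epsilon>\<close> squared
  minus \<open>2 / (M - 2)\<close>, about 0.00024 for these values.\<close>

lemma sum_pot_gap:
  assumes "0 \<le> t" "t < 1"
  defines "M \<equiv> 100000" and "\<epsilon> \<equiv> 1 / 1000"
  shows "(\<Sum>k<6. ennreal (upper_pot M \<epsilon> (cell M \<epsilon> k t))) + ennreal (1 / 10000)
    \<le> (\<Sum>k<6. ennreal (lower_pot \<epsilon> (cell M \<epsilon> k t)))"
proof -
  define \<alpha> where "\<alpha> = 1 / sqrt 3"
  have \<alpha>: "577 / 1000 \<le> \<alpha>" "\<alpha> \<le> 578 / 1000"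
    using inverse_sqrt_3_bounds by (simp_all add: \<alpha>_def)
  have \<alpha>t: "0 \<le> \<alpha> * t" "\<alpha> * t \<le> 1"
    using \<alpha> assms mult_mono[of \<alpha> 1 t 1] by auto
  have div: "a / sqrt 3 = \<alpha> * a" for a by (simp add: \<alpha>_def)
  note eq = cell_def M_def \<epsilon>_def div power2_eq_square algebra_simps
  let ?u = "\<lambda>k. upper_pot M \<epsilon> (cell M \<epsilon> k t)" and ?l = "\<lambda>k. lower_pot \<epsilon> (cell M \<epsilon> k t)"
  have u: "?u 0 = 1/4 - t/4000 + 1/1000000 + 1/99998" "?u 1 = 1/4 - (1 + t)/4000 + 1/1000000 + 1/99998"
    "?u 2 = \<alpha> * (1 - (2 + t)/1000) + 15/1000000" "?u 3 = \<alpha> * (1 - (3 + t)/1000) + 15/1000000"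
    "?u 4 = \<alpha> * (1 - (4 + t)/1000) + 15/1000000" "?u 5 = 0"
    using assms(1,2) by (simp_all add: upper_pot_def eq add_divide_distrib diff_divide_distrib)
  have l: "?l 0 = 1/4 - t/4000" "?l 1 = 1/4 - (1 + t)/4000 - (\<alpha> - 1/4) * t / 1000"
    "?l 2 = 1/4 - (2 + t)/4000" "?l 3 = 1/4 - (3 + t)/4000 - (\<alpha> - 1/4) * t / 1000"
    "?l 4 = \<alpha> * (3 - (4 + t)/1000) - 1/2 - 4 * (\<alpha> - 1/4) / 1000 - 22/1000000" "?l 5 = 0"
    using assms(1,2) by (simp_all add: lower_pot_def eq add_divide_distrib diff_divide_distrib)
  have nonneg: "0 \<le> ?u k \<and> 0 \<le> ?l k" if "k < 6" for k
  proof -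
    have "k \<in> {0, 1, 2, 3, 4, 5}" using that by auto
    then show ?thesis
      using \<alpha> \<alpha>t assms(1,2) by (auto simp only: insert_iff empty_iff u l; simp add: field_simps)
  qed
  have "(\<Sum>k<6. ?u k) + 1 / 10000 \<le> (\<Sum>k<6. ?l k)"
  proof -
    have "{..<6} = {0, 1, 2, 3, 4, 5 :: nat}" by auto
    then show ?thesis
      using \<alpha> by (simp add: u l del: One_nat_def) (simp add: field_simps)
  qed
  then have "ennreal ((\<Sum>k<6. ?u k) + 1 / 10000) \<le> ennreal (\<Sum>k<6. ?l k)"
    by (rule ennreal_leI)
  then show ?thesis
  proof -
    have "(\<Sum>k<6. ennreal (?u k)) = ennreal (\<Sum>k<6. ?u k)" "(\<Sum>k<6. ennreal (?l k)) = ennreal (\<Sum>k<6. ?l k)"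
      using nonneg by (auto intro!: sum_ennreal)
    moreover have "ennreal ((\<Sum>k<6. ?u k) + 1 / 10000) = ennreal (\<Sum>k<6. ?u k) + ennreal (1 / 10000)"
      using nonneg by (intro ennreal_plus sum_nonneg) auto
    ultimately show ?thesis
      using \<open>ennreal ((\<Sum>k<6. ?u k) + 1 / 10000) \<le> ennreal (\<Sum>k<6. ?l k)\<close> by (simp only:)
  qed
qed

theorem mainTheorem2:
  shows "\<exists>M \<epsilon> :: real. M > 0 \<and> \<epsilon> > 0 \<and> prob_space (rho M \<epsilon>) \<and>
           (\<forall>T \<in> DI_class (rho M \<epsilon>). \<not> optimal (rho M \<epsilon>) T)"
proof (intro exI conjI ballI notI)
  \<comment> \<open>\<open>\<epsilon>\<close> is small enough for the first-order gap to dominate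
    the quadratic remainder, and \<open>M\<close> large enough for the far interaction to be
    negligible.\<close>
  define M \<epsilon> :: real where "M = 100000" and "\<epsilon> = 1 / 1000"
  show "M > 0" and \<epsilon>: "\<epsilon> > 0"
    by (simp_all add: M_def \<epsilon>_def)
  have M: "1 + 5 * \<epsilon> < M" "2 < M" "\<epsilon> \<le> 1 / 100"
    by (simp_all add: M_def \<epsilon>_def)
  show prob: "prob_space (rho M \<epsilon>)"
    using \<epsilon> M by (intro prob_space_rho)
  fix T assume T: "T \<in> DI_class (rho M \<epsilon>)" "optimal (rho M \<epsilon>) T"
  let ?L = "\<integral>\<^sup>+x. ennreal (lower_pot \<epsilon> x) \<partial>rho M \<epsilon>" and ?U = "\<integral>\<^sup>+x. ennreal (upper_pot M \<epsilon> x) \<partial>rho M \<epsilon>"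
  have "3 * ?L \<le> monge_cost (rho M \<epsilon>) T"
    using \<epsilon> M T by (intro monge_cost_DI_class_ge)
  also have "\<dots> \<le> monge_cost (rho M \<epsilon>) (competitor M \<epsilon>)"
    using T(2) admissible_competitor[OF \<epsilon> M(1)] by (auto simp: optimal_def intro!: INF_lower)
  also have "\<dots> \<le> 3 * ?U"
    using \<epsilon> M by (intro monge_cost_competitor_le)
  finally have "?L \<le> ?U"
    by (subst (asm) ennreal_mult_le_mult_iff) auto
  \<comment> \<open>1/60000 is a sixth of the 1/10000 in \<open>sum_pot_gap\<close>: the constant is
    counted once in each of the six cells.\<close>
  have gap: "?U + ennreal (1 / 60000) \<le> ?L"
  proof -
    have "?U + ennreal (1 / 60000) = (\<integral>\<^sup>+x. ennreal (upper_pot M \<epsilon> x) + ennreal (1 / 60000) \<partial>rho M \<epsilon>)"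
      using prob_space.emeasure_space_1[OF prob]
      by (subst nn_integral_add) (auto intro!: borel_measurable_Rplus cong: measurable_cong_sets simp: sets_rho)
    also have "\<dots> = (\<integral>\<^sup>+t. ennreal (1 / 6) * (\<Sum>k<6. ennreal (upper_pot M \<epsilon> (cell M \<epsilon> k t)) + ennreal (1 / 60000)) * indicator {0..<1} t \<partial>lborel)"
      using \<epsilon> M by (intro nn_integral_rho) (auto intro!: borel_measurable_Rplus)
    also have "\<dots> \<le> (\<integral>\<^sup>+t. ennreal (1 / 6) * (\<Sum>k<6. ennreal (lower_pot \<epsilon> (cell M \<epsilon> k t))) * indicator {0..<1} t \<partial>lborel)"
    proof (intro nn_integral_mono)
      fix t :: real
      have "6 * ennreal (1 / 60000) = ennreal (1 / 10000)"
        by (simp flip: ennreal_mult ennreal_numeral)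
      then show "ennreal (1 / 6) * (\<Sum>k<6. ennreal (upper_pot M \<epsilon> (cell M \<epsilon> k t)) + ennreal (1 / 60000)) * indicator {0..<1} t
          \<le> ennreal (1 / 6) * (\<Sum>k<6. ennreal (lower_pot \<epsilon> (cell M \<epsilon> k t))) * indicator {0..<1} t"
        using sum_pot_gap[of t, folded M_def \<epsilon>_def]
        by (cases "t \<in> {0..<1}") (auto simp: sum.distrib intro!: mult_left_mono)
    qed
    also have "\<dots> = ?L"
      using \<epsilon> M by (intro nn_integral_rho[symmetric]) (auto intro!: borel_measurable_Rplus)
    finally show ?thesis .
  qed
  \<comment> \<open>Finiteness of \<open>?U\<close> is needed because adding a positive constant is
    strict only below infinity; the crude bound 2 suffices.\<close>
  have "?U \<le> (\<integral>\<^sup>+x. 2 \<partial>rho M \<epsilon>)"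
  proof (rule nn_integral_mono)
    fix x assume "x \<in> space (rho M \<epsilon>)"
    then have "x > 0" by (simp add: space_rho)
    moreover have "(2 - x) / sqrt 3 \<le> 2 * (578 / 1000)"
      using inverse_sqrt_3_bounds \<open>x > 0\<close> mult_mono[of "2 - x" 2 "1 / sqrt 3" "578 / 1000"] by simp
    moreover have "\<epsilon>\<^sup>2 + 1 / (M - 2) \<le> 1" "15 * \<epsilon>\<^sup>2 \<le> 1 / 2"
      by (simp_all add: M_def \<epsilon>_def power2_eq_square)
    moreover have "(2 - x) / 4 \<le> 1"
      using \<open>x > 0\<close> by simp
    ultimately have "(2 - x) / 4 + \<epsilon>\<^sup>2 + 1 / (M - 2) \<le> 2" "(2 - x) / sqrt 3 + 15 * \<epsilon>\<^sup>2 \<le> 2"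
      by linarith+
    then have "upper_pot M \<epsilon> x \<le> 2"
      by (simp add: upper_pot_def)
    then show "ennreal (upper_pot M \<epsilon> x) \<le> 2"
      by (simp flip: ennreal_numeral add: ennreal_leI)
  qed
  also have "\<dots> < \<infinity>"
    using prob_space.emeasure_space_1[OF prob] by simp
  finally have "?U < ?U + ennreal (1 / 60000)"
    by (cases ?U) (auto simp flip: ennreal_plus simp: ennreal_less_iff)
  with gap \<open>?L \<le> ?U\<close> show False
    by (meson leD le_less_trans less_le_trans)
qed

end
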